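(* Let $n\ge2$, let $V$ be the $\mathbb C(q)$-vector space with basis $v_1,\dots,v_n$ (the standard $U_q(\mathfrak{sl}_n)$-module), and let $\Psi:V^{\otimes4}\to V^{\otimes 4}$ be $$\Psi=\Psi_2\Psi_1\Psi_3\Psi_2+(q-q^{-1})(\Psi_1\Psi_2\Psi_1+\Psi_1\Psi_3\Psi_2)+(q-q^{-1})^2\Psi_1\Psi_2,$$ regarded as a linear map $(V\otimes V)^{\otimes2}\to(V\otimes V)^{\otimes2}$. Then $\Psi$ satisfies: (i) the braid equation in $(V\otimes V)^{\otimes3}$: $(\Psi\otimes1)(1\otimes\Psi)(\Psi\otimes1)=(1\otimes\Psi)(\Psi\otimes1)(1\otimes\Psi)$; (ii) the cubic version of the Hecke equation: $(\Psi-1)(\Psi+q^2)(\Psi+q^{-2})=0$. In particular, $\Psi$ is invertible and $$\Psi^{-1}=\Psi_2\Psi_1\Psi_3\Psi_2+(q-q^{-1})(\Psi_2\Psi_3\Psi_2+\Psi_1\Psi_3\Psi_2)+(q-q^{-1})^2\Psi_3\Psi_2;$$ (iii) $\dim(\Psi-1)\big((V\otimes V)\otimes(V\otimes V)\big)=\dim\Lambda^2(V\otimes V)$.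
   Context: $T:V\otimes V\to V\otimes V$ is the $\mathbb C(q)$-linear map given for $1\le i\le j\le n$ by $T(v_i\otimes v_j)=q^{-\delta_{ij}}v_j\otimes v_i$ and $T(v_j\otimes v_i)=q^{\delta_{ij}}v_i\otimes v_j-(q-q^{-1})v_j\otimes v_i$; it satisfies $(T-q^{-1})(T+q)=0$ and the braid equation on $V^{\otimes 3}$. For $1\le i\le3$, $\Psi_i:V^{\otimes4}\to V^{\otimes4}$ is $T$ acting in the $i$-th and $(i+1)$-st tensor factors. In (i), $1$ denotes the identity map of $V\otimes V$. *)

theory Defs
  imports "HOL-Analysis.Analysis" "HOL-Computational_Algebra.Polynomial"
    "HOL-Computational_Algebra.Fraction_Field"
begin

type_synonym ratfun = "complex poly fract"

definition q :: ratfun where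
  "q = Fract [:0, 1:] 1"

lemma q_nonzero: "q \<noteq> 0"
  by (simp add: q_def Zero_fract_def eq_fract)

text \<open>
  The space with a basis indexed by the finite type \<open>'a\<close> is \<open>'k ^ 'a\<close>, with basis vectors
  \<open>axis i 1\<close>. The tensor product of \<open>'k ^ 'a\<close> and \<open>'k ^ 'b\<close> is \<open>'k ^ ('a \<times> 'b)\<close>, where
  \<open>axis (i, j) 1\<close> is the tensor product of \<open>axis i 1\<close> and \<open>axis j 1\<close>.
\<close>

definition tensor ::
  "'k::field ^ 'a::finite \<Rightarrow> 'k ^ 'b::finite \<Rightarrow> 'k ^ ('a \<times> 'b)"  (infixl "\<otimes>" 75) where
  "x \<otimes> y = (\<chi> p. x $ fst p * y $ snd p)"

text \<open>The linear map that sends each basis vector \<open>axis i 1\<close> to \<open>g i\<close>.\<close>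

definition linear_extension :: "('a::finite \<Rightarrow> 'k::field ^ 'b) \<Rightarrow> 'k ^ 'a \<Rightarrow> 'k ^ 'b" where
  "linear_extension g x = (\<Sum>i\<in>UNIV. x $ i *s g i)"

text \<open>For linear \<open>f\<close> and \<open>g\<close>, the tensor product of \<open>f\<close> and \<open>g\<close> (see \<open>tensor_map_tensor\<close>).\<close>

definition tensor_map ::
  "('k::field ^ 'a::finite \<Rightarrow> 'k ^ 'c) \<Rightarrow> ('k ^ 'b::finite \<Rightarrow> 'k ^ 'd)
     \<Rightarrow> 'k ^ ('a \<times> 'b) \<Rightarrow> 'k ^ ('c \<times> 'd)"  (infixl "\<otimes>\<^sub>m" 75) where
  "f \<otimes>\<^sub>m g = linear_extension (\<lambda>(i, j). f (axis i 1) \<otimes> g (axis j 1))"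

definition assoc ::
  "'k ^ (('a::finite \<times> 'b::finite) \<times> 'c::finite) \<Rightarrow> 'k ^ ('a \<times> ('b \<times> 'c))" where
  "assoc x = vec_lambda (\<lambda>(i, j, l). x $ ((i, j), l))"

definition assoc_inv ::
  "'k ^ ('a::finite \<times> ('b::finite \<times> 'c::finite)) \<Rightarrow> 'k ^ (('a \<times> 'b) \<times> 'c)" where
  "assoc_inv x = vec_lambda (\<lambda>((i, j), l). x $ (i, (j, l)))"

text \<open>
  Iterated tensor products are bracketed to the left. \<open>on_left f\<close> lets \<open>f\<close> act on the left
  factor, and \<open>on_right f\<close> lets \<open>f\<close> act on the product of the last two factors, after rebracketing.
\<close>

definition on_left ::
  "('k::field ^ 'a::finite \<Rightarrow> 'k ^ 'a) \<Rightarrow> 'k ^ ('a \<times> 'b::finite) \<Rightarrow> 'k ^ ('a \<times> 'b)" where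
  "on_left f = f \<otimes>\<^sub>m id"

definition on_right ::
  "('k::field ^ ('b::finite \<times> 'c::finite) \<Rightarrow> 'k ^ ('b \<times> 'c))
     \<Rightarrow> 'k ^ (('a::finite \<times> 'b) \<times> 'c) \<Rightarrow> 'k ^ (('a \<times> 'b) \<times> 'c)" where
  "on_right f = assoc_inv \<circ> (id \<otimes>\<^sub>m f) \<circ> assoc"

lemma linear_linear_extension: "Vector_Spaces.linear (*s) (*s) (linear_extension g)"
  by unfold_locales
    (simp_all add: linear_extension_def vec_eq_iff sum.distrib sum_distrib_left algebra_simps)

lemma linear_extension_axis [simp]: "linear_extension g (axis i 1) = g i"
proof -
  have "(\<Sum>j\<in>UNIV. axis i 1 $ j *s g j) = (\<Sum>j\<in>UNIV. if j = i then g j else 0)"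
    by (intro sum.cong) (auto simp: axis_def)
  then show ?thesis by (simp add: linear_extension_def)
qed

lemma linear_extension_unique:
  assumes "Vector_Spaces.linear (*s) (*s) f"
  shows "f = linear_extension (\<lambda>i. f (axis i 1))"
proof
  fix x
  interpret Vector_Spaces.linear "(*s)" "(*s)" f by fact
  have "f x = f (\<Sum>i\<in>UNIV. x $ i *s axis i 1)" by (simp add: basis_expansion)
  also have "\<dots> = linear_extension (\<lambda>i. f (axis i 1)) x"
    by (simp add: sum scale linear_extension_def)
  finally show "f x = linear_extension (\<lambda>i. f (axis i 1)) x" .
qed

lemma tensor_axis: "axis i 1 \<otimes> axis j 1 = axis (i, j) 1"
  by (auto simp: tensor_def axis_def vec_eq_iff)

lemma tensor_map_tensor:
  assumes f: "Vector_Spaces.linear (*s) (*s) f" and g: "Vector_Spaces.linear (*s) (*s) g"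
  shows "(f \<otimes>\<^sub>m g) (x \<otimes> y) = f x \<otimes> g y"
proof -
  have fx: "f x = (\<Sum>i\<in>UNIV. x $ i *s f (axis i 1))"
    by (subst linear_extension_unique[OF f]) (simp add: linear_extension_def)
  have gy: "g y = (\<Sum>i\<in>UNIV. y $ i *s g (axis i 1))"
    by (subst linear_extension_unique[OF g]) (simp add: linear_extension_def)
  have "(f \<otimes>\<^sub>m g) (x \<otimes> y)
      = (\<Sum>(i, j)\<in>UNIV. (x $ i * y $ j) *s (f (axis i 1) \<otimes> g (axis j 1)))"
    by (simp add: tensor_map_def linear_extension_def tensor_def split_def)
  also have "\<dots> = f x \<otimes> g y"
    unfolding fx gy UNIV_Times_UNIV[symmetric]
    by (subst sum.cartesian_product[symmetric])
      (simp add: vec_eq_iff tensor_def sum_product mult_ac)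
  finally show ?thesis .
qed

lemma linear_tensor_map: "Vector_Spaces.linear (*s) (*s) (f \<otimes>\<^sub>m g)"
  unfolding tensor_map_def by (rule linear_linear_extension)

lemma assoc_inverse [simp]: "assoc (assoc_inv x) = x" "assoc_inv (assoc y) = y"
  by (auto simp: assoc_def assoc_inv_def vec_eq_iff)

lemma assoc_tensor: "assoc ((x \<otimes> y) \<otimes> z) = x \<otimes> (y \<otimes> z)"
  by (auto simp: assoc_def tensor_def vec_eq_iff mult.assoc)

lemma linear_assoc:
  "Vector_Spaces.linear (*s) (*s) (assoc :: 'k::field ^ (('a::finite \<times> 'b::finite) \<times> 'c::finite) \<Rightarrow> _)"
  by unfold_locales (auto simp: assoc_def vec_eq_iff algebra_simps)

lemma linear_assoc_inv:
  "Vector_Spaces.linear (*s) (*s) (assoc_inv :: 'k::field ^ ('a::finite \<times> ('b::finite \<times> 'c::finite)) \<Rightarrow> _)"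
  by unfold_locales (auto simp: assoc_inv_def vec_eq_iff algebra_simps)

lemma linear_on_left: "Vector_Spaces.linear (*s) (*s) (on_left f)"
  unfolding on_left_def by (rule linear_tensor_map)

lemma linear_on_right: "Vector_Spaces.linear (*s) (*s) (on_right f)"
  unfolding on_right_def
  by (intro Vector_Spaces.linear_compose[OF linear_assoc]
        Vector_Spaces.linear_compose[OF linear_tensor_map] linear_assoc_inv)

text \<open>
  The exterior square of \<open>W = ratfun ^ 'a\<close> is the quotient of the tensor square of \<open>W\<close> by the
  subspace spanned by all \<open>w \<otimes> w\<close>.
\<close>

definition ext_rel :: "ratfun ^ ('a::finite \<times> 'a) \<Rightarrow> ratfun ^ ('a \<times> 'a) \<Rightarrow> bool" where
  "ext_rel x y \<longleftrightarrow> x - y \<in> vec.span (range (\<lambda>w. w \<otimes> w))"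

lemma equivp_ext_rel: "equivp ext_rel"
proof (rule equivpI)
  show "reflp ext_rel" by (auto simp: reflp_def ext_rel_def vec.span_zero)
  show "symp ext_rel"
  proof (rule sympI)
    fix x y assume "ext_rel x y"
    then show "ext_rel y x" unfolding ext_rel_def using vec.span_neg by fastforce
  qed
  show "transp ext_rel"
  proof (rule transpI)
    fix x y z assume "ext_rel x y" "ext_rel y z"
    then show "ext_rel x z"
      unfolding ext_rel_def using vec.span_add[of "x - y" _ "y - z"] by simp
  qed
qed

quotient_type 'a ext_square = "ratfun ^ ('a::finite \<times> 'a)" / ext_rel
  by (rule equivp_ext_rel)

instantiation ext_square :: (finite) ab_group_add
begin

lift_definition zero_ext_square :: "'a ext_square" is 0 .

lift_definition plus_ext_square ::
  "'a ext_square \<Rightarrow> 'a ext_square \<Rightarrow> 'a ext_square" is "(+)"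
  unfolding ext_rel_def by (subst add_diff_add) (rule vec.span_add)

lift_definition uminus_ext_square :: "'a ext_square \<Rightarrow> 'a ext_square" is uminus
  unfolding ext_rel_def by (subst minus_diff_minus) (rule vec.span_neg)

lift_definition minus_ext_square ::
  "'a ext_square \<Rightarrow> 'a ext_square \<Rightarrow> 'a ext_square" is "(-)"
proof -
  fix x y x' y' :: "ratfun ^ ('a \<times> 'a)"
  assume "ext_rel x y" "ext_rel x' y'"
  moreover have "(x - x') - (y - y') = (x - y) - (x' - y')" by simp
  ultimately show "ext_rel (x - x') (y - y')"
    unfolding ext_rel_def by (simp only: vec.span_diff)
qed

instance
  by standard (transfer; simp add: ext_rel_def algebra_simps vec.span_zero)+

end

definition scale_ext :: "ratfun \<Rightarrow> 'a::finite ext_square \<Rightarrow> 'a ext_square" where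
  "scale_ext c x = abs_ext_square (c *s rep_ext_square x)"

lemma abs_ext_square_eq_iff: "abs_ext_square x = abs_ext_square y \<longleftrightarrow> ext_rel x y"
  by (rule ext_square.abs_eq_iff)

lemma abs_rep_ext_square: "abs_ext_square (rep_ext_square x) = x"
  by (rule Quotient_abs_rep[OF Quotient_ext_square])

lemma scale_ext_abs: "scale_ext c (abs_ext_square x) = abs_ext_square (c *s x)"
proof -
  have "ext_rel (rep_ext_square (abs_ext_square x)) x"
    by (simp add: abs_ext_square_eq_iff[symmetric] abs_rep_ext_square)
  then have "ext_rel (c *s rep_ext_square (abs_ext_square x)) (c *s x)"
    unfolding ext_rel_def vec.scale_right_diff_distrib[symmetric] by (rule vec.span_scale)
  then show ?thesis by (simp add: scale_ext_def abs_ext_square_eq_iff)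
qed

global_interpretation ext_square: vector_space scale_ext
proof
  fix a b :: ratfun and x y :: "'a ext_square"
  obtain x' y' where xy: "x = abs_ext_square x'" "y = abs_ext_square y'"
    by (metis abs_rep_ext_square)
  show "scale_ext a (x + y) = scale_ext a x + scale_ext a y"
    by (simp add: xy scale_ext_abs plus_ext_square.abs_eq vec.scale_right_distrib)
  show "scale_ext (a + b) x = scale_ext a x + scale_ext b x"
    by (simp add: xy scale_ext_abs plus_ext_square.abs_eq vec.scale_left_distrib)
  show "scale_ext a (scale_ext b x) = scale_ext (a * b) x"
    by (simp add: xy scale_ext_abs)
  show "scale_ext 1 x = x"
    by (simp add: xy scale_ext_abs)
qed

text \<open>
  \<open>V\<close> is \<open>ratfun ^ 'n\<close>, with \<open>'n\<close> a finite linearly ordered type of cardinality \<open>n\<close>; the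
  order on \<open>'n\<close> is the order of the basis \<open>v\<^sub>1, \<dots>, v\<^sub>n\<close>.
\<close>

abbreviation v :: "'n::finite \<Rightarrow> ratfun ^ 'n" where
  "v i \<equiv> axis i 1"

definition delta :: "'a \<Rightarrow> 'a \<Rightarrow> int" where
  "delta i j = (if i = j then 1 else 0)"

definition T :: "ratfun ^ ('n::{finite, linorder} \<times> 'n) \<Rightarrow> ratfun ^ ('n \<times> 'n)" where
  "T = linear_extension (\<lambda>(i, j).
     if i \<le> j then q powi (- delta i j) *s (v j \<otimes> v i)
     else q powi (delta i j) *s (v j \<otimes> v i) - (q - inverse q) *s (v i \<otimes> v j))"

lemma T_tensor:
  assumes "i \<le> j"
  shows "T (v i \<otimes> v j) = q powi (- delta i j) *s (v j \<otimes> v i)"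
    and "T (v j \<otimes> v i) = q powi (delta i j) *s (v i \<otimes> v j) - (q - inverse q) *s (v j \<otimes> v i)"
proof -
  show "T (v i \<otimes> v j) = q powi (- delta i j) *s (v j \<otimes> v i)"
    using assms by (simp add: T_def tensor_axis)
  show "T (v j \<otimes> v i) = q powi (delta i j) *s (v i \<otimes> v j) - (q - inverse q) *s (v j \<otimes> v i)"
    using assms
    by (cases "i = j")
      (auto simp: T_def tensor_axis delta_def power_int_minus vec.scale_left_diff_distrib)
qed

lemma linear_T: "Vector_Spaces.linear (*s) (*s) T"
  unfolding T_def by (rule linear_linear_extension)

type_synonym 'n tensor4 = "ratfun ^ ((('n \<times> 'n) \<times> 'n) \<times> 'n)"
type_synonym 'n square2 = "ratfun ^ (('n \<times> 'n) \<times> ('n \<times> 'n))"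

definition Psi1 :: "'n::{finite, linorder} tensor4 \<Rightarrow> 'n tensor4" where
  "Psi1 = on_left (on_left T)"

definition Psi2 :: "'n::{finite, linorder} tensor4 \<Rightarrow> 'n tensor4" where
  "Psi2 = on_left (on_right T)"

definition Psi3 :: "'n::{finite, linorder} tensor4 \<Rightarrow> 'n tensor4" where
  "Psi3 = on_right T"

definition Psi_tensor4 :: "'n::{finite, linorder} tensor4 \<Rightarrow> 'n tensor4" where
  "Psi_tensor4 x =
     (Psi2 \<circ> Psi1 \<circ> Psi3 \<circ> Psi2) x
     + (q - inverse q) *s ((Psi1 \<circ> Psi2 \<circ> Psi1) x + (Psi1 \<circ> Psi3 \<circ> Psi2) x)
     + (q - inverse q)^2 *s (Psi1 \<circ> Psi2) x"

definition Psi_inv_tensor4 :: "'n::{finite, linorder} tensor4 \<Rightarrow> 'n tensor4" where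
  "Psi_inv_tensor4 x =
     (Psi2 \<circ> Psi1 \<circ> Psi3 \<circ> Psi2) x
     + (q - inverse q) *s ((Psi2 \<circ> Psi3 \<circ> Psi2) x + (Psi1 \<circ> Psi3 \<circ> Psi2) x)
     + (q - inverse q)^2 *s (Psi3 \<circ> Psi2) x"

text \<open>A map on the fourth tensor power of \<open>V\<close>, regarded as a map on the tensor square of \<open>V \<otimes> V\<close>.\<close>

definition regroup :: "('n::finite tensor4 \<Rightarrow> 'n tensor4) \<Rightarrow> 'n square2 \<Rightarrow> 'n square2" where
  "regroup f = assoc \<circ> f \<circ> assoc_inv"

definition Psi :: "'n::{finite, linorder} square2 \<Rightarrow> 'n square2" where
  "Psi = regroup Psi_tensor4"

lemma linear_Psi: "Vector_Spaces.linear (*s) (*s) Psi"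
proof -
  interpret P1: Vector_Spaces.linear "(*s)" "(*s)" Psi1
    unfolding Psi1_def by (rule linear_on_left)
  interpret P2: Vector_Spaces.linear "(*s)" "(*s)" Psi2
    unfolding Psi2_def by (rule linear_on_left)
  interpret P3: Vector_Spaces.linear "(*s)" "(*s)" Psi3
    unfolding Psi3_def by (rule linear_on_right)
  have "Vector_Spaces.linear (*s) (*s) Psi_tensor4"
    by unfold_locales
      (simp_all add: Psi_tensor4_def P1.add P1.scale P2.add P2.scale P3.add P3.scale
        vec.scale_right_distrib vec.scale_left_diff_distrib algebra_simps)
  then show ?thesis
    unfolding Psi_def regroup_def
    by (intro Vector_Spaces.linear_compose[OF linear_assoc_inv]
        Vector_Spaces.linear_compose[OF _ linear_assoc])
qed

end

theory Submission
  imports Defs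
begin

text \<open>
  Since \<open>T\<inverse> = T + (q - q\<inverse>)\<close>, the operator \<open>\<Psi>\<close> is the product
  \<open>\<Psi>\<^sub>2\<inverse> \<Psi>\<^sub>1 \<Psi>\<^sub>3\<inverse> \<Psi>\<^sub>2\<close>. It is conjugate to \<open>\<Psi>\<^sub>1 \<Psi>\<^sub>3\<inverse>\<close>, whose factors commute and have
  eigenvalues \<open>q\<inverse>, -q\<close> and \<open>q, -q\<inverse>\<close>; this gives (ii) and the inverse. The braid equation (i)
  already holds in the braid group on six strands. For (iii), the rank of \<open>\<Psi> - 1\<close> is that of
  \<open>\<Psi>\<^sub>1 - \<Psi>\<^sub>3 = T \<otimes> 1 - 1 \<otimes> T\<close>, which is \<open>2 s a\<close> when \<open>s = n (n + 1) / 2\<close> and \<open>a = n (n - 1) / 2\<close> are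
  the multiplicities of the two eigenvalues of \<open>T\<close>, and \<open>2 s a\<close> is \<open>n\<^sup>2\<close> choose \<open>2\<close>.
\<close>

section \<open>Tensor products in coordinates\<close>

lemma linear_component:
  assumes "Vector_Spaces.linear (*s) (*s) f"
  shows "f x $ a = (\<Sum>i\<in>UNIV. x $ i * f (axis i 1) $ a)"
  by (subst linear_extension_unique[OF assms]) (simp add: linear_extension_def)

lemma tensor_map_nth:
  "(f \<otimes>\<^sub>m g) x $ (a, b)
    = (\<Sum>i\<in>UNIV. \<Sum>j\<in>UNIV. x $ (i, j) * (f (axis i 1) $ a * g (axis j 1) $ b))"
proof -
  have "(f \<otimes>\<^sub>m g) x $ (a, b)
      = (\<Sum>(i, j)\<in>UNIV \<times> UNIV. x $ (i, j) * (f (axis i 1) $ a * g (axis j 1) $ b))"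
    by (simp add: tensor_map_def linear_extension_def tensor_def split_def)
  then show ?thesis by (simp only: sum.cartesian_product)
qed

lemma sum_times_axis:
  "(\<Sum>j\<in>UNIV. f j * axis j (1::'k::field) $ b) = f (b::'b::finite)"
proof -
  have "(\<Sum>j\<in>UNIV. f j * axis j (1::'k::field) $ b) = (\<Sum>j\<in>UNIV. if j = b then f j else 0)"
    by (intro sum.cong) (auto simp: axis_def)
  then show ?thesis by simp
qed

text \<open>Fixing the index of the untouched factor leaves a slice on which \<open>f\<close> acts.
  In this form identities between operators on different factors can be checked entry by
  entry.\<close>

lemma on_left_nth:
  assumes "Vector_Spaces.linear (*s) (*s) f"
  shows "on_left f x $ (a, b) = f (\<chi> i. x $ (i, b)) $ a"
proof -
  have "on_left f x $ (a, b)
      = (\<Sum>i\<in>UNIV. \<Sum>j\<in>UNIV. (x $ (i, j) * f (axis i 1) $ a) * axis j 1 $ b)"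
    unfolding on_left_def tensor_map_nth id_apply mult.assoc ..
  then show ?thesis
    unfolding sum_times_axis linear_component[OF assms, of "vec_lambda _"] vec_lambda_beta .
qed

lemma id_tensor_map_nth:
  assumes "Vector_Spaces.linear (*s) (*s) f"
  shows "(id \<otimes>\<^sub>m f) x $ (a, b) = f (\<chi> j. x $ (a, j)) $ b"
proof -
  have "(id \<otimes>\<^sub>m f) x $ (a, b)
      = (\<Sum>j\<in>UNIV. \<Sum>i\<in>UNIV. x $ (i, j) * (axis i 1 $ a * f (axis j 1) $ b))"
    unfolding tensor_map_nth id_apply by (rule sum.swap)
  also have "\<dots> = (\<Sum>j\<in>UNIV. \<Sum>i\<in>UNIV. (x $ (i, j) * f (axis j 1) $ b) * axis i 1 $ a)"
    unfolding mult.assoc by (subst mult.commute[of "axis _ _ $ _"]) (rule refl)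
  finally show ?thesis
    unfolding sum_times_axis linear_component[OF assms, of "vec_lambda _"] vec_lambda_beta .
qed

lemma on_right_nth:
  assumes "Vector_Spaces.linear (*s) (*s) f"
  shows "on_right f x $ ((a, b), c) = f (\<chi> p. x $ ((a, fst p), snd p)) $ (b, c)"
  by (simp add: on_right_def assoc_inv_def assoc_def id_tensor_map_nth[OF assms] split_def)

lemma on_left_comp:
  assumes "Vector_Spaces.linear (*s) (*s) f" "Vector_Spaces.linear (*s) (*s) g"
  shows "on_left (f \<circ> g) = on_left f \<circ> on_left g"
  by (auto simp: fun_eq_iff vec_eq_iff on_left_nth assms
      on_left_nth[OF Vector_Spaces.linear_compose[OF assms(2,1)]])

lemma on_right_comp:
  assumes "Vector_Spaces.linear (*s) (*s) f" "Vector_Spaces.linear (*s) (*s) g"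
  shows "on_right (f \<circ> g) = on_right f \<circ> on_right g"
  by (auto simp: fun_eq_iff vec_eq_iff on_right_nth assms
      on_right_nth[OF Vector_Spaces.linear_compose[OF assms(2,1)]])

lemma on_left_id: "on_left id = id"
  by (auto simp: fun_eq_iff vec_eq_iff on_left_nth vec.linear_id)

lemma on_right_id: "on_right id = id"
  by (auto simp: fun_eq_iff vec_eq_iff on_right_nth vec.linear_id)

section \<open>The Hecke operator\<close>

text \<open>
  With \<open>swap_coeff\<close> vanishing on the diagonal, the quadratic relation holds coefficientwise.
\<close>

definition swap_coeff :: "'a \<Rightarrow> 'a \<Rightarrow> 'k::field" where
  "swap_coeff i j = (if i = j then 0 else 1)"

definition diag_coeff :: "'k::field \<Rightarrow> 'a::linorder \<Rightarrow> 'a \<Rightarrow> 'k" where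
  "diag_coeff Q i j = (if i = j then inverse Q else if j < i then inverse Q - Q else 0)"

lemma swap_coeff_simps:
  "swap_coeff i i = 0" "i \<noteq> j \<Longrightarrow> swap_coeff i j = 1"
  by (simp_all add: swap_coeff_def)

lemma diag_coeff_simps:
  "diag_coeff Q i i = inverse Q"
  "i < j \<Longrightarrow> diag_coeff Q i j = 0"
  "i < j \<Longrightarrow> diag_coeff Q j i = inverse Q - Q"
  by (auto simp: diag_coeff_def)

text \<open>The operator \<open>T\<close> in coordinates, over any field and with parameter
  \<open>Q\<close> for \<open>q\<close>: an entry of the image involves only the same entry and the
  one with exchanged indices.\<close>

definition hecke :: "'k::field \<Rightarrow> 'k ^ ('n::{finite, linorder} \<times> 'n) \<Rightarrow> 'k ^ ('n \<times> 'n)" where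
  "hecke Q x = (\<chi> p. swap_coeff (fst p) (snd p) * x $ (snd p, fst p)
      + diag_coeff Q (fst p) (snd p) * x $ p)"

lemma hecke_nth:
  "hecke Q x $ (i, j) = swap_coeff i j * x $ (j, i) + diag_coeff Q i j * x $ (i, j)"
  by (simp add: hecke_def)

lemma linear_hecke: "Vector_Spaces.linear (*s) (*s) (hecke Q)"
  by unfold_locales (auto simp: vec_eq_iff hecke_nth algebra_simps)

text \<open>For two distinct indices the coefficients form a 2 by 2 matrix of trace
  \<open>inverse Q - Q\<close> and determinant -1, so this is Cayley-Hamilton. Using functions of
  two indices allows instantiation at any two neighbouring indices of a larger tensor.\<close>

lemma hecke_coeff_quadratic:
  fixes x :: "'a::linorder \<Rightarrow> 'a \<Rightarrow> 'k::field"
  assumes Q: "Q \<noteq> 0"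
  defines "s \<equiv> \<lambda>x a b. swap_coeff a b * x b a + diag_coeff Q a b * x a b"
  shows "s (s x) a b = x a b - (Q - inverse Q) * s x a b"
  using Q unfolding s_def
  by (cases a b rule: linorder_cases)
    (simp_all add: swap_coeff_simps diag_coeff_simps less_imp_neq less_imp_neq[symmetric],
      simp_all add: field_simps)

lemma hecke_axis:
  "hecke Q (axis (i, j) 1) =
     (if i < j then axis (j, i) 1
      else if i = j then inverse Q *s axis (j, i) 1
      else axis (j, i) 1 - (Q - inverse Q) *s axis (i, j) 1)"
  by (auto simp: vec_eq_iff hecke_nth swap_coeff_def diag_coeff_def axis_def)

lemma T_eq_hecke:
  "(T :: ratfun ^ ('n::{finite, linorder} \<times> 'n) \<Rightarrow> _) = hecke q"
proof -
  have "T (axis (i, j) 1) = hecke q (axis (i, j) 1)" for i j :: 'n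
    unfolding hecke_axis
    by (cases i j rule: linorder_cases)
      (simp_all only: T_def linear_extension_axis tensor_axis delta_def split if_True if_False
        less_imp_le order_refl less_irrefl not_less[symmetric] inverse_1 not_False_eq_True
        less_imp_neq[symmetric] less_imp_neq power_int_minus power_int_1_right power_int_0_right minus_zero
        vec.scale_one refl simp_thms less_not_sym)
  then have "(\<lambda>p :: 'n \<times> 'n. T (axis p 1)) = (\<lambda>p. hecke q (axis p 1))"
    by (metis surj_pair)
  then show ?thesis
    by (metis linear_extension_unique linear_T linear_hecke)
qed

text \<open>The coefficients depend only on the relative order of the indices. Once
  \<open>a\<close>, \<open>b\<close>, \<open>c\<close> are compared pairwise, each case is an
  identity of rational expressions in \<open>Q\<close>.\<close>

lemma hecke_coeff_braid:
  fixes x :: "'a::linorder \<Rightarrow> 'a \<Rightarrow> 'a \<Rightarrow> 'k::field"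
  assumes Q: "Q \<noteq> 0"
  defines "s \<equiv> \<lambda>x a b c. swap_coeff a b * x b a c + diag_coeff Q a b * x a b c"
    and "t \<equiv> \<lambda>x a b c. swap_coeff b c * x a c b + diag_coeff Q b c * x a b c"
  shows "s (t (s x)) a b c = t (s (t x)) a b c"
  using Q unfolding s_def t_def
  by (cases a b rule: linorder_cases; cases b c rule: linorder_cases;
      cases a c rule: linorder_cases)
    (simp_all add: swap_coeff_simps diag_coeff_simps less_imp_neq less_imp_neq[symmetric],
      simp_all add: field_simps)

section \<open>The braid equation for conjugates\<close>

text \<open>
  With \<open>P = a b c d\<close> and \<open>N = B C D E\<close>, both sides equal \<open>D E c d N P\<close>, because \<open>P\<close> and \<open>N\<close> shift the
  index of each generator they pass by one. Each capital letter is the inverse of the small one.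
\<close>

lemma conjugation_braid:
  fixes a b c d e B C D E :: "'v \<Rightarrow> 'v"
  assumes inverses: "\<And>x. b (B x) = x" "\<And>x. B (b x) = x" "\<And>x. c (C x) = x" "\<And>x. C (c x) = x"
      "\<And>x. d (D x) = x" "\<And>x. D (d x) = x" "\<And>x. e (E x) = x" "\<And>x. E (e x) = x"
    and braid: "\<And>x. a (b (a x)) = b (a (b x))" "\<And>x. b (c (b x)) = c (b (c x))"
      "\<And>x. c (d (c x)) = d (c (d x))" "\<And>x. d (e (d x)) = e (d (e x))"
    and commute: "\<And>x. c (a x) = a (c x)" "\<And>x. d (a x) = a (d x)" "\<And>x. e (a x) = a (e x)"
      "\<And>x. d (b x) = b (d x)" "\<And>x. e (b x) = b (e x)" "\<And>x. e (c x) = c (e x)"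
  shows "B (a (C (b (D (c (E (d (B (a (C (b x)))))))))))
    = D (c (E (d (B (a (C (b (D (c (E (d x)))))))))))"
proof -
  have Ca: "C (a x) = a (C x)" and Da: "D (a x) = a (D x)" and Ea: "E (a x) = a (E x)"
    and Db: "D (b x) = b (D x)" and Eb: "E (b x) = b (E x)" and Ec: "E (c x) = c (E x)"
    and dB: "d (B x) = B (d x)"
    and DB: "D (B x) = B (D x)" and EB: "E (B x) = B (E x)" and EC: "E (C x) = C (E x)" for x
    by (metis inverses commute)+
  have neg_braid: "B (C (B x)) = C (B (C x))" "C (D (C x)) = D (C (D x))"
    "D (E (D x)) = E (D (E x))" for x
    by (metis inverses braid)+
  \<comment> \<open>Braid relations with some letters carried to the other side; for example
    \<open>C b c = b c B\<close> is \<open>b c b = c b c\<close> multiplied by \<open>C\<close> on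
    the left and \<open>B\<close> on the right.\<close>
  have mixed: "B (C (b x)) = c (B (C x))" "C (D (c x)) = d (C (D x))"
    "b (c (B x)) = C (b (c x))" "c (d (C x)) = D (c (d x))" for x
    by (metis inverses braid)+
  define P where "P x = a (b (c (d x)))" for x
  define N where "N x = B (C (D (E x)))" for x
  have P: "P (B x) = C (P x)" "P (C x) = D (P x)" "P (a x) = b (P x)" "P (b x) = c (P x)" for x
  proof -
    show "P (B x) = C (P x)" unfolding P_def dB mixed Ca ..
    show "P (C x) = D (P x)" unfolding P_def mixed Da Db ..
    show "P (a x) = b (P x)" unfolding P_def commute braid ..
    show "P (b x) = c (P x)" unfolding P_def commute(4) braid commute(1) ..
  qed
  have N: "N (C x) = D (N x)" "N (D x) = E (N x)" "N (b x) = c (N x)" "N (c x) = d (N x)" for x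
  proof -
    show "N (C x) = D (N x)" unfolding N_def EC neg_braid DB ..
    show "N (D x) = E (N x)" unfolding N_def neg_braid EC[symmetric] EB[symmetric] ..
    show "N (b x) = c (N x)" unfolding N_def Eb Db mixed ..
    show "N (c x) = d (N x)" unfolding N_def Ec mixed dB ..
  qed
  \<comment> \<open>Capitals move left past small letters of distant index, which collects the words
    \<open>N\<close> and \<open>P\<close>.\<close>
  have "B (a (C (b (D (c (E (d (B (a (C (b x)))))))))))
      = N (P (B (C (a (b x)))))"
    unfolding N_def P_def by (simp add: Ca Da Ea Db Eb Ec)
  also have "\<dots> = D (E (c (d (N (P x)))))"
    by (simp only: P N)
  also have "\<dots> = D (c (E (d (B (a (C (b (D (c (E (d x)))))))))))"
    unfolding N_def P_def by (simp add: Ca Da Ea Db Eb Ec)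
  finally show ?thesis .
qed

section \<open>Three Hecke generators and the conjugate \<open>psi\<close> of
  \<open>t1 t3_inv\<close>\<close>

locale hecke_triple =
  fixes Q :: "'k::field" and t1 t2 t3 :: "'k ^ 'i::finite \<Rightarrow> 'k ^ 'i"
  assumes Q_nonzero: "Q \<noteq> 0"
    and linear_t1: "Vector_Spaces.linear (*s) (*s) t1"
    and linear_t2: "Vector_Spaces.linear (*s) (*s) t2"
    and linear_t3: "Vector_Spaces.linear (*s) (*s) t3"
    and quadratic: "t1 (t1 x) = x - (Q - inverse Q) *s t1 x"
      "t2 (t2 x) = x - (Q - inverse Q) *s t2 x"
      "t3 (t3 x) = x - (Q - inverse Q) *s t3 x"
    and braid: "t1 (t2 (t1 x)) = t2 (t1 (t2 x))" "t2 (t3 (t2 x)) = t3 (t2 (t3 x))"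
    and commute: "t3 (t1 x) = t1 (t3 x)"
begin

sublocale t1: Vector_Spaces.linear "(*s)" "(*s)" t1 by (rule linear_t1)
sublocale t2: Vector_Spaces.linear "(*s)" "(*s)" t2 by (rule linear_t2)
sublocale t3: Vector_Spaces.linear "(*s)" "(*s)" t3 by (rule linear_t3)

definition h :: 'k where "h = Q - inverse Q"

definition t1_inv where "t1_inv x = t1 x + h *s x"
definition t2_inv where "t2_inv x = t2 x + h *s x"
definition t3_inv where "t3_inv x = t3 x + h *s x"

lemmas quadratic_h = quadratic[folded h_def]

text \<open>The quadratic relation reads \<open>t (t + h) = 1\<close>.\<close>

lemma inverses:
  "t1 (t1_inv x) = x" "t1_inv (t1 x) = x"
  "t2 (t2_inv x) = x" "t2_inv (t2 x) = x"
  "t3 (t3_inv x) = x" "t3_inv (t3 x) = x"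
  by (simp_all add: t1_inv_def t2_inv_def t3_inv_def t1.add t1.scale t2.add t2.scale
      t3.add t3.scale quadratic_h)

lemma linear_t2_inv: "Vector_Spaces.linear (*s) (*s) t2_inv"
  by unfold_locales (simp_all add: t2_inv_def t2.add t2.scale vec_eq_iff algebra_simps)

lemma linear_t3_inv: "Vector_Spaces.linear (*s) (*s) t3_inv"
  by unfold_locales (simp_all add: t3_inv_def t3.add t3.scale vec_eq_iff algebra_simps)

sublocale t2_inv: Vector_Spaces.linear "(*s)" "(*s)" t2_inv by (rule linear_t2_inv)
sublocale t3_inv: Vector_Spaces.linear "(*s)" "(*s)" t3_inv by (rule linear_t3_inv)

definition psi where "psi x = t2_inv (t1 (t3_inv (t2 x)))"

text \<open>Multiplying out \<open>(t2 + h) t1 (t3 + h) t2\<close> gives four terms; the braid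
  relation rewrites \<open>t2 t1 t2\<close> as \<open>t1 t2 t1\<close>. This matches
  \<open>psi\<close> with the sum that defines \<open>Psi\<close>.\<close>

lemma psi_expand:
  "psi x = t2 (t1 (t3 (t2 x))) + h *s (t1 (t2 (t1 x)) + t1 (t3 (t2 x))) + h^2 *s t1 (t2 x)"
  by (simp add: psi_def t2_inv_def t3_inv_def t1.add t1.scale t2.add t2.scale braid
      vec_eq_iff algebra_simps power2_eq_square)

definition psi_inv where "psi_inv x = t2_inv (t3 (t1_inv (t2 x)))"

lemma psi_inv_expand:
  "psi_inv x = t2 (t1 (t3 (t2 x))) + h *s (t2 (t3 (t2 x)) + t1 (t3 (t2 x))) + h^2 *s t3 (t2 x)"
  by (simp add: psi_inv_def t2_inv_def t1_inv_def t3.add t3.scale t2.add t2.scale commute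
      vec_eq_iff algebra_simps power2_eq_square)

lemma commute_inv: "t3_inv (t1 x) = t1 (t3_inv x)"
  by (simp add: t3_inv_def t1.add t1.scale commute)

lemma psi_inverses: "psi (psi_inv x) = x" "psi_inv (psi x) = x"
  by (simp_all add: psi_def psi_inv_def inverses)

text \<open>The polynomial is \<open>(X - 1)(X + Q^2)(X + Q^-2)\<close> multiplied out; its roots
  are the products of an eigenvalue of \<open>t1\<close> with one of \<open>t3_inv\<close>. The
  proof checks it for \<open>u = t1 t3_inv\<close> and then conjugates by \<open>t2\<close>.\<close>

lemma psi_cubic:
  "psi (psi (psi x)) + (Q^2 + inverse Q^2 - 1) *s psi (psi x)
     - (Q^2 + inverse Q^2 - 1) *s psi x - x = 0"
proof -
  define u where "u x = t1 (t3_inv x)" for x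
  have t3_inv_quadratic: "t3_inv (t3_inv x) = x + h *s t3_inv x" for x
    by (subst t3_inv_def) (simp add: inverses)
  \<comment> \<open>As the factors commute, the square of \<open>u\<close> is
    \<open>(1 - h t1)(1 + h t3_inv)\<close>; all powers of \<open>u\<close> stay in the span of 1,
    \<open>t1\<close>, \<open>t3_inv\<close> and \<open>u\<close>.\<close>
  have u2: "u (u x) = x + h *s t3_inv x - h *s t1 x - h^2 *s u x" for x
    by (simp add: u_def commute_inv t3_inv_quadratic quadratic_h t1.add t1.scale
        vec_eq_iff algebra_simps power2_eq_square)
  have u_linear: "u (x + y) = u x + u y" "u (x - y) = u x - u y" "u (c *s x) = c *s u x" for x y c
    by (simp_all add: u_def t1.add t1.scale t1.diff t3_inv.add t3_inv.scale t3_inv.diff)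
  have u3: "u (t3_inv x) = t1 x + h *s u x" "u (t1 x) = t3_inv x - h *s u x" for x
    by (simp_all add: u_def commute_inv t3_inv_quadratic quadratic_h t1.add t1.scale)
  have k: "Q^2 + inverse Q^2 - 1 = h^2 + 1"
    using Q_nonzero by (simp add: h_def power2_diff)
  have cubic: "u (u (u x)) + (h^2 + 1) *s u (u x) - (h^2 + 1) *s u x - x = 0" for x
    unfolding u2 u_linear u3
    by (simp add: vec_eq_iff algebra_simps power2_eq_square)
  have "psi y = t2_inv (u (t2 y))" for y
    by (simp add: psi_def u_def)
  then have "psi (psi (psi x)) + (h^2 + 1) *s psi (psi x) - (h^2 + 1) *s psi x - x
      = t2_inv (u (u (u (t2 x))) + (h^2 + 1) *s u (u (t2 x)) - (h^2 + 1) *s u (t2 x) - t2 x)"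
    by (simp only: inverses t2_inv.add t2_inv.diff t2_inv.scale)
  then show ?thesis
    by (simp only: k cubic t2_inv.zero)
qed

text \<open>Writing the identity as \<open>t2_inv t3 t3_inv t2\<close> lets the bijections
  \<open>t2_inv\<close> and \<open>t3_inv t2\<close> be split off, so that \<open>psi - 1\<close>
  and \<open>t1 - t3\<close> have the same rank.\<close>

lemma psi_minus_id: "psi x - x = t2_inv (t1 (t3_inv (t2 x)) - t3 (t3_inv (t2 x)))"
  by (simp add: psi_def inverses t2_inv.diff)

lemma range_psi_minus_id: "range (\<lambda>x. psi x - x) = t2_inv ` range (\<lambda>x. t1 x - t3 x)"
proof -
  have "range (\<lambda>x. t3_inv (t2 x)) = UNIV"
    by (rule surjI[of _ "\<lambda>x. t2_inv (t3 x)"]) (simp add: inverses)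
  then have "range (\<lambda>x. t1 x - t3 x) = (\<lambda>x. t1 x - t3 x) ` range (\<lambda>x. t3_inv (t2 x))"
    by (rule arg_cong[OF sym])
  then show ?thesis
    by (simp only: psi_minus_id image_image)
qed

lemma dim_range_psi_minus_id:
  "vec.dim (range (\<lambda>x. psi x - x)) = vec.dim (range (\<lambda>x. t1 x - t3 x))"
proof -
  have "inj t2_inv" by (metis injI inverses(3))
  then show ?thesis
    unfolding range_psi_minus_id
    by (rule vec.dim_image_eq[OF linear_t2_inv inj_on_subset[OF _ subset_UNIV]])
qed

end

section \<open>Six tensor factors\<close>

text \<open>What \<open>Psi2\<close> becomes when the four factors are grouped into two
  pairs.\<close>

definition middle ::
  "('k::field ^ ('b::finite \<times> 'c::finite) \<Rightarrow> 'k ^ ('b \<times> 'c))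
     \<Rightarrow> 'k ^ (('a::finite \<times> 'b) \<times> ('c \<times> 'd::finite)) \<Rightarrow> 'k ^ (('a \<times> 'b) \<times> ('c \<times> 'd))" where
  "middle f = assoc \<circ> on_left (on_right f) \<circ> assoc_inv"

lemma middle_nth:
  assumes "Vector_Spaces.linear (*s) (*s) f"
  shows "middle f x $ ((a, b), (c, d)) = f (\<chi> r. x $ ((a, fst r), (snd r, d))) $ (b, c)"
  by (simp add: middle_def assoc_def assoc_inv_def on_left_nth[OF linear_on_right]
      on_right_nth[OF assms])

lemma linear_middle: "Vector_Spaces.linear (*s) (*s) (middle f)"
  unfolding middle_def
  by (intro Vector_Spaces.linear_compose[OF linear_assoc_inv]
      Vector_Spaces.linear_compose[OF linear_on_left] linear_assoc)

lemma assoc_on_left_on_left: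
  assumes "Vector_Spaces.linear (*s) (*s) f"
  shows "assoc (on_left (on_left f) x) = on_left f (assoc x)"
  by (auto simp: vec_eq_iff assoc_def on_left_nth[OF linear_on_left] on_left_nth[OF assms])

lemma assoc_on_left_on_right: "assoc (on_left (on_right f) x) = middle f (assoc x)"
  by (simp add: middle_def)

lemma assoc_on_right: "assoc (on_right f x) = (id \<otimes>\<^sub>m f) (assoc x)"
  by (simp add: on_right_def)

text \<open>Both sides are one double sum over the entries of \<open>x\<close>, taken in either
  order. This is the source of all commutation between operators on disjoint factors.\<close>

lemma linear_swap:
  assumes "Vector_Spaces.linear (*s) (*s) f" "Vector_Spaces.linear (*s) (*s) g"
  shows "f (\<chi> i. g (\<chi> j. x i j) $ b) $ a = g (\<chi> j. f (\<chi> i. x i j) $ a) $ b"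
proof -
  have "f (\<chi> i. g (\<chi> j. x i j) $ b) $ a
      = (\<Sum>i\<in>UNIV. \<Sum>j\<in>UNIV. x i j * g (axis j 1) $ b * f (axis i 1) $ a)"
    by (simp only: linear_component[OF assms(1), of "vec_lambda _"]
        linear_component[OF assms(2), of "vec_lambda _"] vec_lambda_beta sum_distrib_right)
  also have "\<dots> = (\<Sum>j\<in>UNIV. \<Sum>i\<in>UNIV. x i j * f (axis i 1) $ a * g (axis j 1) $ b)"
    by (subst sum.swap) (simp only: mult.assoc mult.commute[of "g _ $ _"])
  also have "\<dots> = g (\<chi> j. f (\<chi> i. x i j) $ a) $ b"
    by (simp only: linear_component[OF assms(1), of "vec_lambda _"]
        linear_component[OF assms(2), of "vec_lambda _"] vec_lambda_beta sum_distrib_right)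
  finally show ?thesis .
qed

lemma on_left_id_tensor_map_commute:
  assumes f: "Vector_Spaces.linear (*s) (*s) f" and g: "Vector_Spaces.linear (*s) (*s) g"
  shows "(id \<otimes>\<^sub>m g) (on_left f x) = on_left f ((id \<otimes>\<^sub>m g) x)"
  by (auto simp: vec_eq_iff on_left_nth[OF f] id_tensor_map_nth[OF g] linear_swap[OF f g])

text \<open>Both sides let \<open>f\<close> act on the second of three factors. Hence the last
  generator of the left pair of factors is the first generator of the right pair.\<close>

lemma on_left_id_tensor_map:
  assumes "Vector_Spaces.linear (*s) (*s) f"
  shows "on_left (id \<otimes>\<^sub>m f) = on_right (on_left f)"
  by (auto simp: fun_eq_iff vec_eq_iff on_left_nth[OF linear_tensor_map] on_right_nth[OF linear_on_left]
      on_left_nth[OF assms] id_tensor_map_nth[OF assms])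

lemma on_right_id_tensor_map:
  assumes "Vector_Spaces.linear (*s) (*s) f"
  shows "on_right (id \<otimes>\<^sub>m f) = id \<otimes>\<^sub>m f"
  by (auto simp: fun_eq_iff vec_eq_iff on_right_nth[OF linear_tensor_map] id_tensor_map_nth[OF assms])

lemma on_left_on_left_on_right_commute:
  assumes f: "Vector_Spaces.linear (*s) (*s) f" and g: "Vector_Spaces.linear (*s) (*s) g"
  shows "on_right g (on_left (on_left f) x) = on_left (on_left f) (on_right g x)"
  by (auto simp: vec_eq_iff on_left_nth[OF linear_on_left] on_left_nth[OF f] on_right_nth[OF g]
      linear_swap[OF f g])

text \<open>On three pairs, that is six single factors, one operator touches the second and third
  and the other the fourth and fifth.\<close>

lemma on_left_on_right_middle_commute:
  assumes f: "Vector_Spaces.linear (*s) (*s) f" and g: "Vector_Spaces.linear (*s) (*s) g"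
  shows "on_right (middle g) (on_left (middle f) x) = on_left (middle f) (on_right (middle g) x)"
  by (auto simp: vec_eq_iff on_left_nth[OF linear_middle] middle_nth[OF f] middle_nth[OF g]
      on_right_nth[OF linear_middle] linear_swap[OF f g])

section \<open>The Hecke relations on four tensor factors\<close>

lemma hecke_square_nth:
  "on_left (hecke Q) x $ ((a, b), (c, d))
    = swap_coeff a b * x $ ((b, a), (c, d)) + diag_coeff Q a b * x $ ((a, b), (c, d))"
  "middle (hecke Q) x $ ((a, b), (c, d))
    = swap_coeff b c * x $ ((a, c), (b, d)) + diag_coeff Q b c * x $ ((a, b), (c, d))"
  "(id \<otimes>\<^sub>m hecke Q) x $ ((a, b), (c, d))
    = swap_coeff c d * x $ ((a, b), (d, c)) + diag_coeff Q c d * x $ ((a, b), (c, d))"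
  by (simp_all add: on_left_nth middle_nth id_tensor_map_nth linear_hecke hecke_nth)

lemma hecke_triple_square:
  assumes Q: "Q \<noteq> 0"
  shows "hecke_triple Q (on_left (hecke Q)) (middle (hecke Q))
    (id \<otimes>\<^sub>m hecke Q :: 'k::field ^ (('n::{finite, linorder} \<times> 'n) \<times> ('n \<times> 'n)) \<Rightarrow> _)"
proof (rule hecke_triple.intro)
  fix x :: "'k ^ (('n \<times> 'n) \<times> ('n \<times> 'n))"
  let ?t1 = "on_left (hecke Q)" and ?t2 = "middle (hecke Q)" and ?t3 = "id \<otimes>\<^sub>m hecke Q"
  show "Q \<noteq> 0" by fact
  show "?t1 (?t1 x) = x - (Q - inverse Q) *s ?t1 x"
  proof (simp only: vec_eq_iff split_paired_All, intro allI)
    fix a b c d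
    show "?t1 (?t1 x) $ ((a, b), (c, d)) = (x - (Q - inverse Q) *s ?t1 x) $ ((a, b), (c, d))"
      unfolding vector_minus_component vector_smult_component hecke_square_nth
      by (rule hecke_coeff_quadratic[OF Q, where x = "\<lambda>a b. x $ ((a, b), (c, d))"])
  qed
  show "?t2 (?t2 x) = x - (Q - inverse Q) *s ?t2 x"
  proof (simp only: vec_eq_iff split_paired_All, intro allI)
    fix a b c d
    show "?t2 (?t2 x) $ ((a, b), (c, d)) = (x - (Q - inverse Q) *s ?t2 x) $ ((a, b), (c, d))"
      unfolding vector_minus_component vector_smult_component hecke_square_nth
      by (rule hecke_coeff_quadratic[OF Q, where x = "\<lambda>b c. x $ ((a, b), (c, d))"])
  qed
  show "?t3 (?t3 x) = x - (Q - inverse Q) *s ?t3 x"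
  proof (simp only: vec_eq_iff split_paired_All, intro allI)
    fix a b c d
    show "?t3 (?t3 x) $ ((a, b), (c, d)) = (x - (Q - inverse Q) *s ?t3 x) $ ((a, b), (c, d))"
      unfolding vector_minus_component vector_smult_component hecke_square_nth
      by (rule hecke_coeff_quadratic[OF Q, where x = "\<lambda>c d. x $ ((a, b), (c, d))"])
  qed
  show "?t1 (?t2 (?t1 x)) = ?t2 (?t1 (?t2 x))"
  proof (simp only: vec_eq_iff split_paired_All, intro allI)
    fix a b c d
    show "?t1 (?t2 (?t1 x)) $ ((a, b), (c, d)) = ?t2 (?t1 (?t2 x)) $ ((a, b), (c, d))"
      unfolding hecke_square_nth
      by (rule hecke_coeff_braid[OF Q, where x = "\<lambda>a b c. x $ ((a, b), (c, d))"])
  qed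
  show "?t2 (?t3 (?t2 x)) = ?t3 (?t2 (?t3 x))"
  proof (simp only: vec_eq_iff split_paired_All, intro allI)
    fix a b c d
    show "?t2 (?t3 (?t2 x)) $ ((a, b), (c, d)) = ?t3 (?t2 (?t3 x)) $ ((a, b), (c, d))"
      unfolding hecke_square_nth
      by (rule hecke_coeff_braid[OF Q, where x = "\<lambda>b c d. x $ ((a, b), (c, d))"])
  qed
  show "?t3 (?t1 x) = ?t1 (?t3 x)"
    by (rule on_left_id_tensor_map_commute[OF linear_hecke linear_hecke])
qed (rule linear_on_left linear_middle linear_tensor_map)+

section \<open>The braid equation on six tensor factors\<close>

lemma on_left_on_left:
  assumes "Vector_Spaces.linear (*s) (*s) f" "Vector_Spaces.linear (*s) (*s) g"
  shows "on_left f (on_left g x) = on_left (f \<circ> g) x"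
  by (simp add: on_left_comp[OF assms])

lemma on_right_on_right:
  assumes "Vector_Spaces.linear (*s) (*s) f" "Vector_Spaces.linear (*s) (*s) g"
  shows "on_right f (on_right g x) = on_right (f \<circ> g) x"
  by (simp add: on_right_comp[OF assms])

lemma on_left_inverse:
  assumes "f \<circ> g = id" "Vector_Spaces.linear (*s) (*s) f" "Vector_Spaces.linear (*s) (*s) g"
  shows "on_left f (on_left g x) = x"
  by (simp add: on_left_on_left[OF assms(2,3)] assms(1) on_left_id)

lemma on_right_inverse:
  assumes "f \<circ> g = id" "Vector_Spaces.linear (*s) (*s) f" "Vector_Spaces.linear (*s) (*s) g"
  shows "on_right f (on_right g x) = x"
  by (simp add: on_right_on_right[OF assms(2,3)] assms(1) on_right_id)

text \<open>The operators on factors 12, 23, 34, 45, 56 serve as the five braid generators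
  \<open>a\<close>, ..., \<open>e\<close>. The left copy of \<open>P\<close> is
  \<open>B a C b\<close> and the right copy is \<open>D c E d\<close>, so
  \<open>conjugation_braid\<close> applies.\<close>

lemma psi_hecke_braid:
  fixes Q :: "'k::field"
  assumes Q: "Q \<noteq> 0"
  defines "P \<equiv> hecke_triple.psi Q (on_left (hecke Q)) (middle (hecke Q))
    (id \<otimes>\<^sub>m hecke Q :: 'k ^ (('n::{finite, linorder} \<times> 'n) \<times> ('n \<times> 'n)) \<Rightarrow> _)"
  shows "on_left P \<circ> on_right P \<circ> on_left P = on_right P \<circ> on_left P \<circ> on_right P"
proof -
  define t1 t2 t3 :: "'k ^ (('n \<times> 'n) \<times> ('n \<times> 'n)) \<Rightarrow> 'k ^ (('n \<times> 'n) \<times> ('n \<times> 'n))"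
    where t: "t1 = on_left (hecke Q)" "t2 = middle (hecke Q)" "t3 = id \<otimes>\<^sub>m hecke Q"
  interpret hecke_triple Q t1 t2 t3
    unfolding t by (rule hecke_triple_square[OF Q])
  have P: "P = t2_inv \<circ> (t1 \<circ> (t3_inv \<circ> t2))"
    unfolding P_def t[symmetric] by (simp add: fun_eq_iff psi_def)
  have lin: "Vector_Spaces.linear (*s) (*s) (t3_inv \<circ> t2)"
    "Vector_Spaces.linear (*s) (*s) (t1 \<circ> (t3_inv \<circ> t2))"
    by (intro Vector_Spaces.linear_compose[of _ "(*s)"] linear_t1 linear_t2 linear_t3_inv)+
  note comps = linear_t1 linear_t2 linear_t3 linear_t2_inv linear_t3_inv lin
  have left: "on_left P x = on_left t2_inv (on_left t1 (on_left t3_inv (on_left t2 x)))"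
    for x :: "'k ^ ((('n \<times> 'n) \<times> ('n \<times> 'n)) \<times> ('n \<times> 'n))"
    unfolding P on_left_comp[OF linear_t2_inv lin(2)] on_left_comp[OF linear_t1 lin(1)]
      on_left_comp[OF linear_t3_inv linear_t2] by simp
  have right: "on_right P x = on_right t2_inv (on_right t1 (on_right t3_inv (on_right t2 x)))"
    for x :: "'k ^ ((('n \<times> 'n) \<times> ('n \<times> 'n)) \<times> ('n \<times> 'n))"
    unfolding P on_right_comp[OF linear_t2_inv lin(2)] on_right_comp[OF linear_t1 lin(1)]
      on_right_comp[OF linear_t3_inv linear_t2] by simp
  have id: "t2 \<circ> t2_inv = id" "t2_inv \<circ> t2 = id" "t3 \<circ> t3_inv = id" "t3_inv \<circ> t3 = id"
    by (simp_all add: fun_eq_iff inverses)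
  have cubes: "t1 \<circ> (t2 \<circ> t1) = t2 \<circ> (t1 \<circ> t2)" "t2 \<circ> (t3 \<circ> t2) = t3 \<circ> (t2 \<circ> t3)"
    "t3 \<circ> t1 = t1 \<circ> t3"
    by (simp_all add: fun_eq_iff braid commute)
  note comp_lin = Vector_Spaces.linear_compose[of _ "(*s)"]
  have left_right: "on_left t3 = on_right t1"
    unfolding t by (rule on_left_id_tensor_map[OF linear_hecke])
  show ?thesis
    unfolding fun_eq_iff comp_apply left right
  proof (intro allI conjugation_braid[where a = "on_left t1" and b = "on_left t2"
        and c = "on_right t1" and d = "on_right t2" and e = "on_right t3"
        and B = "on_left t2_inv" and C = "on_left t3_inv" and D = "on_right t2_inv"
        and E = "on_right t3_inv"])
    fix x :: "'k ^ ((('n \<times> 'n) \<times> ('n \<times> 'n)) \<times> ('n \<times> 'n))"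
    show "on_left t2 (on_left t2_inv x) = x" "on_left t2_inv (on_left t2 x) = x"
      "on_right t2 (on_right t2_inv x) = x" "on_right t2_inv (on_right t2 x) = x"
      "on_right t3 (on_right t3_inv x) = x" "on_right t3_inv (on_right t3 x) = x"
      by (intro on_left_inverse on_right_inverse id comps)+
    \<comment> \<open>The generator on factors 34 is written from the right and its inverse from the
      left; \<open>left_right\<close> identifies the two views.\<close>
    show "on_right t1 (on_left t3_inv x) = x" "on_left t3_inv (on_right t1 x) = x"
      unfolding left_right[symmetric] by (intro on_left_inverse id comps)+
    show "on_left t1 (on_left t2 (on_left t1 x)) = on_left t2 (on_left t1 (on_left t2 x))"
      by (simp only: on_left_on_left comps cubes comp_lin)
    show "on_left t2 (on_right t1 (on_left t2 x)) = on_right t1 (on_left t2 (on_right t1 x))"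
      by (simp only: left_right[symmetric] on_left_on_left comps cubes comp_lin)
    show "on_right t1 (on_right t2 (on_right t1 x)) = on_right t2 (on_right t1 (on_right t2 x))"
      by (simp only: on_right_on_right comps cubes comp_lin)
    show "on_right t2 (on_right t3 (on_right t2 x)) = on_right t3 (on_right t2 (on_right t3 x))"
      by (simp only: on_right_on_right comps cubes comp_lin)
    show "on_right t1 (on_left t1 x) = on_left t1 (on_right t1 x)"
      by (simp only: left_right[symmetric] on_left_on_left comps cubes)
    show "on_right t2 (on_left t1 x) = on_left t1 (on_right t2 x)"
      unfolding t by (intro on_left_on_left_on_right_commute linear_hecke linear_middle)
    show "on_right t3 (on_left t1 x) = on_left t1 (on_right t3 x)"
      unfolding t by (intro on_left_on_left_on_right_commute linear_hecke linear_tensor_map)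
    show "on_right t2 (on_left t2 x) = on_left t2 (on_right t2 x)"
      unfolding t by (intro on_left_on_right_middle_commute linear_hecke)
    show "on_right t3 (on_left t2 x) = on_left t2 (on_right t3 x)"
      unfolding t on_right_id_tensor_map[OF linear_hecke]
      by (intro on_left_id_tensor_map_commute linear_hecke linear_middle)
    show "on_right t3 (on_right t1 x) = on_right t1 (on_right t3 x)"
      by (simp only: on_right_on_right comps cubes)
  qed
qed

section \<open>The rank of the Hecke difference\<close>

text \<open>Eigenvectors are indexed by the pairs themselves: weakly increasing pairs carry
  \<open>inverse Q\<close>, strictly decreasing ones \<open>- Q\<close>.\<close>

definition eigenvalue :: "'k::field \<Rightarrow> 'n::linorder \<times> 'n \<Rightarrow> 'k" where
  "eigenvalue Q p = (if fst p \<le> snd p then inverse Q else - Q)"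

definition scale_eigen :: "'k::field \<Rightarrow> 'k ^ ('n::{finite, linorder} \<times> 'n) \<Rightarrow> 'k ^ ('n \<times> 'n)" where
  "scale_eigen Q x = (\<chi> p. eigenvalue Q p * x $ p)"

text \<open>
  The images of \<open>axis (i, j) 1\<close> and \<open>axis (j, i) 1\<close> for \<open>i < j\<close> are the eigenvectors
  \<open>v\<^sub>i \<otimes> v\<^sub>j + Q\<inverse> v\<^sub>j \<otimes> v\<^sub>i\<close> and \<open>v\<^sub>i \<otimes> v\<^sub>j - Q v\<^sub>j \<otimes> v\<^sub>i\<close>.
\<close>

definition eigenbasis :: "'k::field \<Rightarrow> 'k ^ ('n::{finite, linorder} \<times> 'n) \<Rightarrow> 'k ^ ('n \<times> 'n)" where
  "eigenbasis Q x = vec_lambda (\<lambda>(i, j).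
     if i = j then x $ (i, j) else if i < j then x $ (i, j) + x $ (j, i)
     else inverse Q * x $ (j, i) - Q * x $ (i, j))"

text \<open>Inverts the 2 by 2 blocks of \<open>eigenbasis\<close>, which have determinant
  \<open>- (Q + inverse Q)\<close>.\<close>

definition eigenbasis_inv :: "'k::field \<Rightarrow> 'k ^ ('n::{finite, linorder} \<times> 'n) \<Rightarrow> 'k ^ ('n \<times> 'n)" where
  "eigenbasis_inv Q x = vec_lambda (\<lambda>(i, j).
     if i = j then x $ (i, j) else if i < j then (Q * x $ (i, j) + x $ (j, i)) / (Q + inverse Q)
     else (inverse Q * x $ (j, i) - x $ (i, j)) / (Q + inverse Q))"

lemma eigenvalue_simps:
  "eigenvalue Q (i, i) = inverse Q"
  "i < j \<Longrightarrow> eigenvalue Q (i, j) = inverse Q"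
  "i < j \<Longrightarrow> eigenvalue Q (j, i) = - Q"
  by (auto simp: eigenvalue_def)

lemma eigenbasis_nth:
  "eigenbasis Q x $ (i, i) = x $ (i, i)"
  "i < j \<Longrightarrow> eigenbasis Q x $ (i, j) = x $ (i, j) + x $ (j, i)"
  "i < j \<Longrightarrow> eigenbasis Q x $ (j, i) = inverse Q * x $ (i, j) - Q * x $ (j, i)"
  by (auto simp: eigenbasis_def)

lemma eigenbasis_inv_nth:
  "eigenbasis_inv Q x $ (i, i) = x $ (i, i)"
  "i < j \<Longrightarrow> eigenbasis_inv Q x $ (i, j) = (Q * x $ (i, j) + x $ (j, i)) / (Q + inverse Q)"
  "i < j \<Longrightarrow> eigenbasis_inv Q x $ (j, i) = (inverse Q * x $ (i, j) - x $ (j, i)) / (Q + inverse Q)"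
  by (auto simp: eigenbasis_inv_def)

lemma linear_scale_eigen: "Vector_Spaces.linear (*s) (*s) (scale_eigen Q)"
  by unfold_locales (auto simp: vec_eq_iff scale_eigen_def algebra_simps)

lemma linear_eigenbasis: "Vector_Spaces.linear (*s) (*s) (eigenbasis Q)"
  by unfold_locales (auto simp: vec_eq_iff eigenbasis_def algebra_simps)

lemma linear_eigenbasis_inv: "Vector_Spaces.linear (*s) (*s) (eigenbasis_inv Q)"
  by unfold_locales (auto simp: vec_eq_iff eigenbasis_inv_def add_divide_distrib
      diff_divide_distrib algebra_simps)

lemma hecke_eigenbasis:
  assumes "Q \<noteq> 0"
  shows "hecke Q (eigenbasis Q x) = eigenbasis Q (scale_eigen Q x)"
proof (simp only: vec_eq_iff split_paired_All, intro allI)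
  fix i j
  show "hecke Q (eigenbasis Q x) $ (i, j) = eigenbasis Q (scale_eigen Q x) $ (i, j)"
    using assms
    by (cases i j rule: linorder_cases)
      (simp_all add: hecke_nth swap_coeff_simps diag_coeff_simps eigenbasis_nth scale_eigen_def
        eigenvalue_simps field_simps)
qed

lemma eigenbasis_inverse:
  assumes Q: "Q \<noteq> 0" "Q + inverse Q \<noteq> 0"
  shows "eigenbasis Q (eigenbasis_inv Q x) = x" "eigenbasis_inv Q (eigenbasis Q x) = x"
proof -
  define R where "R = inverse Q"
  have R: "Q * R = 1" "Q + R \<noteq> 0" using Q by (simp_all add: R_def)
  have QR: "Q * (R * y) = y" for y
    using R by (simp add: mult.assoc[symmetric])
  have lt: "(Q * a + b) / (Q + R) + (R * a - b) / (Q + R) = a" for a b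
    using R(2) by (simp add: add_divide_distrib[symmetric] distrib_right[symmetric])
  have gt: "R * ((Q * a + b) / (Q + R)) - Q * ((R * a - b) / (Q + R)) = b" for a b
  proof -
    have "R * (Q * a + b) - Q * (R * a - b) = b * (Q + R)"
      by (simp add: algebra_simps)
    then show ?thesis
      using R(2) by (simp add: diff_divide_distrib[symmetric])
  qed
  have lt': "(Q * (a + b) + (R * a - Q * b)) / (Q + R) = a" for a b
  proof -
    have "Q * (a + b) + (R * a - Q * b) = a * (Q + R)" by (simp add: algebra_simps)
    then show ?thesis using R(2) by simp
  qed
  have gt': "(R * (a + b) - (R * a - Q * b)) / (Q + R) = b" for a b
  proof -
    have "R * (a + b) - (R * a - Q * b) = b * (Q + R)" by (simp add: algebra_simps)
    then show ?thesis using R(2) by simp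
  qed
  have "eigenbasis Q (eigenbasis_inv Q x) $ (i, j) = x $ (i, j)" for i j
    by (cases i j rule: linorder_cases)
      (simp_all only: eigenbasis_nth eigenbasis_inv_nth R_def[symmetric] lt gt)
  then show "eigenbasis Q (eigenbasis_inv Q x) = x" by (simp add: vec_eq_iff)
  have "eigenbasis_inv Q (eigenbasis Q x) $ (i, j) = x $ (i, j)" for i j
    by (cases i j rule: linorder_cases)
      (simp_all only: eigenbasis_nth eigenbasis_inv_nth R_def[symmetric] lt' gt')
  then show "eigenbasis_inv Q (eigenbasis Q x) = x" by (simp add: vec_eq_iff)
qed

section \<open>Rank of a diagonal map and counting of pairs\<close>

lemma dim_range_diagonal:
  fixes c :: "'a::finite \<Rightarrow> 'k::field"
  shows "vec.dim (range (\<lambda>z. \<chi> p. c p * z $ p)) = card {p. c p \<noteq> 0}"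
proof -
  have "range (\<lambda>z. \<chi> p. c p * z $ p) = {x. \<forall>p. p \<notin> {p. c p \<noteq> 0} \<longrightarrow> x $ p = 0}"
  proof (intro subset_antisym subsetI)
    fix x :: "'k ^ 'a" assume "x \<in> {x. \<forall>p. p \<notin> {p. c p \<noteq> 0} \<longrightarrow> x $ p = 0}"
    \<comment> \<open>Where \<open>c\<close> vanishes both sides are 0, whatever the quotient
      is.\<close>
    then have "x = (\<chi> p. c p * (\<chi> p. x $ p / c p) $ p)"
      by (auto simp: vec_eq_iff)
    then show "x \<in> range (\<lambda>z. \<chi> p. c p * z $ p)" by (rule range_eqI)
  qed auto
  then show ?thesis by (simp only: dim_substandard_cart)
qed

text \<open>The square splits into increasing pairs, decreasing pairs and the diagonal, and
  exchanging coordinates matches the first two. The additive form avoids subtraction and division of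
  natural numbers.\<close>

lemma card_less_pairs:
  fixes f :: "'a::finite \<Rightarrow> 'b::linorder"
  assumes "inj f"
  shows "2 * card {(x, y). f x < f y} + CARD('a) = CARD('a)^2"
proof -
  let ?L = "{(x, y). f x < f y}" and ?G = "{(x, y). f y < f x}" and ?D = "range (\<lambda>x :: 'a. (x, x))"
  have "?G = prod.swap ` ?L" by auto
  then have G: "card ?G = card ?L" by (simp add: card_image)
  have D: "card ?D = CARD('a)" by (simp add: card_image inj_on_def)
  have U: "(UNIV :: ('a \<times> 'a) set) = ?L \<union> (?G \<union> ?D)"
    using assms by (auto simp: inj_eq)
  have "CARD('a)^2 = card (UNIV :: ('a \<times> 'a) set)"
    by (simp add: power2_eq_square)
  also have "\<dots> = card ?L + (card ?G + card ?D)"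
    unfolding U by (subst card_Un_disjoint; (subst card_Un_disjoint)?) auto
  finally show ?thesis using G D by simp
qed

text \<open>If the two eigenvalues occur \<open>s\<close> and \<open>a\<close> times,
  \<open>2 * s * a\<close> ordered pairs have different eigenvalues. Since \<open>s - a = n\<close>
  and \<open>s + a = n * n\<close>, the claim \<open>4 * s * a + (s + a) = (s + a)^2\<close> amounts
  to \<open>(s - a)^2 = s + a\<close>.\<close>

lemma card_eigenvalue_neq:
  assumes "inverse Q \<noteq> - (Q::'k::field)"
  shows "2 * card {(p :: 'n::{finite, linorder} \<times> 'n, r :: 'n \<times> 'n). eigenvalue Q p \<noteq> eigenvalue Q r}
      + CARD('n \<times> 'n) = CARD('n \<times> 'n)^2"
proof -
  let ?S = "{p :: 'n \<times> 'n. fst p \<le> snd p}" and ?A = "{p :: 'n \<times> 'n. snd p < fst p}"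
  have "{(p :: 'n \<times> 'n, r :: 'n \<times> 'n). eigenvalue Q p \<noteq> eigenvalue Q r} = ?S \<times> ?A \<union> ?A \<times> ?S"
    using assms by (auto simp: eigenvalue_def split: if_splits)
  also have "card \<dots> = card (?S \<times> ?A) + card (?A \<times> ?S)"
    by (rule card_Un_disjoint) auto
  finally have 1: "card {(p :: 'n \<times> 'n, r :: 'n \<times> 'n). eigenvalue Q p \<noteq> eigenvalue Q r} = 2 * card ?S * card ?A"
    by (simp add: card_cartesian_product)
  have "card (UNIV :: ('n \<times> 'n) set) = card (?S \<union> ?A)"
    by (rule arg_cong[of _ _ card]) auto
  also have "\<dots> = card ?S + card ?A"
    by (rule card_Un_disjoint) auto
  finally have 2: "CARD('n \<times> 'n) = card ?S + card ?A" .
  have "?A = prod.swap ` {(x, y). x < y}" by auto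
  then have "card ?A = card {(x, y :: 'n). x < y}" by (simp add: card_image)
  then have "2 * card ?A + CARD('n) = CARD('n \<times> 'n)"
    using card_less_pairs[of "id :: 'n \<Rightarrow> 'n"] by (simp add: power2_eq_square)
  with 2 have 3: "card ?S = card ?A + CARD('n)" by linarith
  have 4: "CARD('n \<times> 'n) = CARD('n) * CARD('n)" by simp
  obtain s a n where [simp]: "card ?S = s" "card ?A = a" "CARD('n) = n" by blast
  from 2 3 4 have eq: "n * n = s + a" "s = a + n" by auto
  then have "4 * s * a + (s + a) = (s + a)^2"
    by (simp add: algebra_simps power2_eq_square)
  then show ?thesis unfolding 1 2 by simp
qed

text \<open>On tensor products of eigenvectors the operator is diagonal, with differences of two
  eigenvalues as entries; its rank counts the pairs of distinct eigenvalues.\<close>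

lemma dim_range_hecke_difference:
  fixes Q :: "'k::field"
  assumes Q: "Q \<noteq> 0" "Q + inverse Q \<noteq> 0"
  shows "2 * vec.dim (range (\<lambda>x :: 'k ^ (('n::{finite, linorder} \<times> 'n) \<times> ('n \<times> 'n)).
        on_left (hecke Q) x - (id \<otimes>\<^sub>m hecke Q) x)) + CARD('n \<times> 'n) = CARD('n \<times> 'n)^2"
proof -
  let ?K = "\<lambda>x :: 'k ^ (('n \<times> 'n) \<times> ('n \<times> 'n)). on_left (eigenbasis Q) ((id \<otimes>\<^sub>m eigenbasis Q) x)"
  let ?K' = "\<lambda>x :: 'k ^ (('n \<times> 'n) \<times> ('n \<times> 'n)). (id \<otimes>\<^sub>m eigenbasis_inv Q) (on_left (eigenbasis_inv Q) x)"
  let ?d = "\<lambda>x :: 'k ^ (('n \<times> 'n) \<times> ('n \<times> 'n)). on_left (hecke Q) x - (id \<otimes>\<^sub>m hecke Q) x"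
  let ?c = "\<lambda>(p :: 'n \<times> 'n, r :: 'n \<times> 'n). eigenvalue Q p - eigenvalue Q r"
  note lin = linear_hecke linear_scale_eigen linear_eigenbasis linear_eigenbasis_inv
  have inv: "eigenbasis Q \<circ> eigenbasis_inv Q = id" "eigenbasis_inv Q \<circ> eigenbasis Q = id"
    by (simp_all add: fun_eq_iff eigenbasis_inverse[OF Q])
  have right_inv: "(id \<otimes>\<^sub>m eigenbasis Q) ((id \<otimes>\<^sub>m eigenbasis_inv Q) x) = x"
    "(id \<otimes>\<^sub>m eigenbasis_inv Q) ((id \<otimes>\<^sub>m eigenbasis Q) x) = x" for x :: "'k ^ (('n \<times> 'n) \<times> ('n \<times> 'n))"
    by (simp_all add: vec_eq_iff id_tensor_map_nth lin eigenbasis_inverse[OF Q])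
  have KK: "?K (?K' x) = x" "?K' (?K x) = x" for x :: "'k ^ (('n \<times> 'n) \<times> ('n \<times> 'n))"
    by (simp_all add: right_inv on_left_inverse inv lin)
  have linear_K: "Vector_Spaces.linear (*s) (*s) ?K"
    using Vector_Spaces.linear_compose[OF linear_tensor_map linear_on_left]
    by (simp add: comp_def)
  interpret K: Vector_Spaces.linear "(*s)" "(*s)" ?K by (rule linear_K)
  have dK: "?d (?K x) = ?K (\<chi> p. ?c p * x $ p)" for x :: "'k ^ (('n \<times> 'n) \<times> ('n \<times> 'n))"
  proof -
    have "on_left (hecke Q) (?K x) = on_left (eigenbasis Q) (on_left (scale_eigen Q) ((id \<otimes>\<^sub>m eigenbasis Q) x))"
      by (simp add: vec_eq_iff on_left_nth lin hecke_eigenbasis[OF Q(1)])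
    also have "\<dots> = ?K (on_left (scale_eigen Q) x)"
      by (simp add: on_left_id_tensor_map_commute lin)
    finally have 1: "on_left (hecke Q) (?K x) = ?K (on_left (scale_eigen Q) x)" .
    have "(id \<otimes>\<^sub>m hecke Q) (?K x) = on_left (eigenbasis Q) ((id \<otimes>\<^sub>m hecke Q) ((id \<otimes>\<^sub>m eigenbasis Q) x))"
      by (simp add: on_left_id_tensor_map_commute lin)
    also have "(id \<otimes>\<^sub>m hecke Q) ((id \<otimes>\<^sub>m eigenbasis Q) x) = (id \<otimes>\<^sub>m eigenbasis Q) ((id \<otimes>\<^sub>m scale_eigen Q) x)"
      by (simp add: vec_eq_iff id_tensor_map_nth lin hecke_eigenbasis[OF Q(1)])
    finally have 2: "(id \<otimes>\<^sub>m hecke Q) (?K x) = ?K ((id \<otimes>\<^sub>m scale_eigen Q) x)" .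
    have "on_left (scale_eigen Q) x - (id \<otimes>\<^sub>m scale_eigen Q) x = (\<chi> p. ?c p * x $ p)"
      by (simp add: vec_eq_iff split_paired_All on_left_nth id_tensor_map_nth lin)
        (simp add: scale_eigen_def algebra_simps)
    then show ?thesis
      unfolding 1 2 by (simp only: K.diff[symmetric])
  qed
  have "range ?K = UNIV" by (rule surjI[of _ ?K']) (rule KK(1))
  then have "range ?d = ?d ` range ?K" by (simp only:)
  also have "\<dots> = ?K ` range (\<lambda>x. \<chi> p. ?c p * x $ p)"
    by (simp only: image_image dK)
  finally have "vec.dim (range ?d) = vec.dim (range (\<lambda>x :: 'k ^ (('n \<times> 'n) \<times> ('n \<times> 'n)). \<chi> p. ?c p * x $ p))"
    using vec.dim_image_eq[OF linear_K inj_on_subset[OF inj_on_inverseI[of UNIV ?K' ?K] subset_UNIV]] KK(2)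
    by simp
  also have "\<dots> = card {p :: ('n \<times> 'n) \<times> ('n \<times> 'n). ?c p \<noteq> 0}"
    by (rule dim_range_diagonal)
  also have "{p :: ('n \<times> 'n) \<times> ('n \<times> 'n). ?c p \<noteq> 0} = {(p, r). eigenvalue Q p \<noteq> eigenvalue Q r}"
    by auto
  finally show ?thesis
    using card_eigenvalue_neq[of Q, where 'n = 'n] Q(2)
    by (simp only:) (simp add: eq_neg_iff_add_eq_0 add.commute)
qed

section \<open>The dimension of the exterior square\<close>

definition ext_antisym :: "'a::finite ext_square \<Rightarrow> 'a \<Rightarrow> 'a \<Rightarrow> ratfun" where
  "ext_antisym y a b = rep_ext_square y $ (a, b) - rep_ext_square y $ (b, a)"

text \<open>Every \<open>w \<otimes> w\<close> is a symmetric tensor, hence so is their span, and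
  the choice of representative cancels in the antisymmetrized entry.\<close>

lemma ext_antisym_abs: "ext_antisym (abs_ext_square x) a b = x $ (a, b) - x $ (b, a)"
proof -
  let ?z = "rep_ext_square (abs_ext_square x) - x"
  have "?z \<in> vec.span (range (\<lambda>w. w \<otimes> w))"
    using abs_rep_ext_square[of "abs_ext_square x"]
    unfolding abs_ext_square_eq_iff ext_rel_def .
  then have "?z $ (a, b) = ?z $ (b, a)"
  proof (induction rule: vec.span_induct)
    case base
    show ?case by (rule vec.subspaceI) simp_all
  qed (auto simp: tensor_def mult.commute)
  then show ?thesis
    unfolding ext_antisym_def by (simp add: algebra_simps)
qed

lemma ext_antisym_linear:
  "ext_antisym 0 a b = 0"
  "ext_antisym (u + w) a b = ext_antisym u a b + ext_antisym w a b"
  "ext_antisym (scale_ext c u) a b = c * ext_antisym u a b"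
proof -
  obtain u' w' where uw: "u = abs_ext_square u'" "w = abs_ext_square w'"
    by (metis abs_rep_ext_square)
  show "ext_antisym 0 a b = 0"
    unfolding zero_ext_square_def by (simp add: ext_antisym_abs)
  show "ext_antisym (u + w) a b = ext_antisym u a b + ext_antisym w a b"
    unfolding uw plus_ext_square.abs_eq ext_antisym_abs by simp
  show "ext_antisym (scale_ext c u) a b = c * ext_antisym u a b"
    unfolding uw scale_ext_abs ext_antisym_abs by (simp add: right_diff_distrib)
qed

lemma tensor_add_square: "(x + y) \<otimes> (x + y) = x \<otimes> x + x \<otimes> y + y \<otimes> x + y \<otimes> y"
  by (simp add: vec_eq_iff tensor_def algebra_simps)

text \<open>The exchanged pair \<open>(y, x)\<close> is decreasing under \<open>f\<close>, so it
  differs from \<open>p\<close> and the second entry is 0.\<close>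

lemma axis_antisym:
  fixes f :: "'a::finite \<Rightarrow> 'b::linorder"
  assumes "p \<in> {(x, y). f x < f y}" "(x, y) \<in> {(x, y). f x < f y}"
  shows "axis p (1::'k::field) $ (x, y) - axis p 1 $ (y, x) = of_bool (p = (x, y))"
  using assms by (auto simp: axis_def)

text \<open>The classes of \<open>axis (x, y) 1\<close> with \<open>f x < f y\<close> form a basis:
  the functionals \<open>ext_antisym\<close> are dual to them, and antisymmetry gives
  spanning.\<close>

lemma dim_ext_square:
  "2 * ext_square.dim (UNIV :: 'a::finite ext_square set) + CARD('a) = CARD('a)^2"
proof -
  \<comment> \<open>An injection into the naturals supplies the order that selects one pair from
    each two.\<close>
  obtain f :: "'a \<Rightarrow> nat" where f: "inj f"
    using finite_imp_inj_to_nat_seg[OF finite_class.finite_UNIV] by blast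
  define b where "b p = abs_ext_square (axis p 1)" for p :: "'a \<times> 'a"
  let ?P = "{(x, y). f x < f y}"
  have antisym_b: "ext_antisym (b p) x y = of_bool (p = (x, y))"
    if "p \<in> ?P" "(x, y) \<in> ?P" for p x y
    unfolding b_def ext_antisym_abs using that by (rule axis_antisym)
  have inj: "inj_on b ?P"
  proof (rule inj_onI)
    fix p r assume pr: "p \<in> ?P" "r \<in> ?P" "b p = b r"
    obtain x y where p: "p = (x, y)" by fastforce
    have "(of_bool (p = p) :: ratfun) = of_bool (r = p)"
      using antisym_b[of p x y] antisym_b[of r x y] pr by (simp only: p)
    then show "p = r" by (simp only: of_bool_eq_iff simp_thms)
  qed
  have indep: "ext_square.independent (b ` ?P)"
  proof
    assume "ext_square.dependent (b ` ?P)"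
    then obtain p where p: "p \<in> ?P" and span: "b p \<in> ext_square.span (b ` ?P - {b p})"
      unfolding ext_square.dependent_def by blast
    obtain x y where xy: "p = (x, y)" by fastforce
    \<comment> \<open>The functional dual to \<open>b p\<close> kills all other vectors of the
      family but takes the value 1 on \<open>b p\<close>.\<close>
    from span have "ext_antisym (b p) x y = 0"
    proof (induction rule: ext_square.span_induct)
      case base
      show ?case by (intro ext_square.subspaceI) (simp_all add: ext_antisym_linear)
    next
      case (step r)
      then obtain r' where r': "r = b r'" "r' \<in> ?P" "r' \<noteq> (x, y)" using xy by blast
      show ?case
        using antisym_b[OF r'(2) p[unfolded xy]] by (simp only: r' of_bool_eq simp_thms)
    qed
    then show False
      using antisym_b[OF p p[unfolded xy]] by (simp only: xy simp_thms of_bool_eq zero_neq_one)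
  qed
  have b_span: "b p \<in> ext_square.span (b ` ?P)" for p
  proof -
    obtain x y where xy: "p = (x, y)" by fastforce
    consider "f x < f y" | "f y < f x" | "x = y"
      using f by (metis inj_eq linorder_neqE_nat)
    then show ?thesis
    proof cases
      case 1
      then show ?thesis by (auto simp: xy intro: ext_square.span_base)
    next
      case 2
      \<comment> \<open>Polarization: the symmetrized product of two basis vectors is a combination
        of squares \<open>w \<otimes> w\<close>, so it vanishes in the quotient.\<close>
      have "(axis (x, y) 1 :: ratfun ^ ('a \<times> 'a)) - - axis (y, x) 1
          = (axis x 1 + axis y 1) \<otimes> (axis x 1 + axis y 1) - axis x 1 \<otimes> axis x 1 - axis y 1 \<otimes> axis y 1"
        by (simp add: tensor_add_square tensor_axis)
      also have "\<dots> \<in> vec.span (range (\<lambda>w. w \<otimes> w))"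
        by (intro vec.span_diff vec.span_base rangeI)
      finally have "b (x, y) = - b (y, x)"
        by (simp add: b_def uminus_ext_square.abs_eq ext_rel_def abs_ext_square_eq_iff)
      moreover have "b (y, x) \<in> ext_square.span (b ` ?P)"
        using 2 by (auto intro: ext_square.span_base)
      ultimately show ?thesis
        unfolding xy by (simp only: ext_square.span_neg)
    next
      case 3
      have "axis x 1 \<otimes> axis x 1 \<in> vec.span (range (\<lambda>w :: ratfun ^ 'a. w \<otimes> w))"
        by (intro vec.span_base rangeI)
      then have "b p = 0"
        by (simp add: xy 3 b_def zero_ext_square_def ext_rel_def abs_ext_square_eq_iff tensor_axis)
      then show ?thesis by (simp add: ext_square.span_zero)
    qed
  qed
  have span: "UNIV \<subseteq> ext_square.span (b ` ?P)"
  proof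
    fix y :: "'a ext_square"
    have sum_abs: "abs_ext_square (\<Sum>p\<in>A. x p) = (\<Sum>p\<in>A. abs_ext_square (x p))"
      for x :: "'a \<times> 'a \<Rightarrow> _" and A
      by (induction A rule: infinite_finite_induct)
        (simp_all add: zero_ext_square_def plus_ext_square.abs_eq[symmetric])
    obtain x where "y = abs_ext_square x" by (metis abs_rep_ext_square)
    also have "\<dots> = abs_ext_square (\<Sum>p\<in>UNIV. x $ p *s axis p 1)"
      by (simp only: basis_expansion)
    also have "\<dots> = (\<Sum>p\<in>UNIV. scale_ext (x $ p) (b p))"
      by (simp add: sum_abs b_def scale_ext_abs)
    finally show "y \<in> ext_square.span (b ` ?P)"
      by (simp only:) (intro ext_square.span_sum ext_square.span_scale b_span)
  qed
  have "ext_square.dim (UNIV :: 'a ext_square set) = card (b ` ?P)"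
    using ext_square.basis_card_eq_dim[OF subset_UNIV span indep] by simp
  then show ?thesis
    using card_less_pairs[OF f] by (simp add: card_image[OF inj])
qed

section \<open>The operator \<open>\<Psi>\<close>\<close>

text \<open>Multiplying out the three factors and using \<open>A * B = 1\<close> gives the cubic;
  \<open>A\<close> and \<open>B\<close> will be the squares of \<open>q\<close> and
  \<open>inverse q\<close>.\<close>

lemma cubic_factors:
  fixes f :: "'k::field ^ 'i::finite \<Rightarrow> 'k ^ 'i"
  assumes "Vector_Spaces.linear (*s) (*s) f" and AB: "A * B = 1"
    and cubic: "\<And>x. f (f (f x)) + (A + B - 1) *s f (f x) - (A + B - 1) *s f x - x = 0"
  shows "(\<lambda>x. f x - x) \<circ> (\<lambda>x. f x + A *s x) \<circ> (\<lambda>x. f x + B *s x) = (\<lambda>x. 0)"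
proof
  fix x
  interpret Vector_Spaces.linear "(*s)" "(*s)" f by fact
  have AB': "A * (B * y) = y" for y
    using AB by (simp add: mult.assoc[symmetric])
  have "((\<lambda>x. f x - x) \<circ> (\<lambda>x. f x + A *s x) \<circ> (\<lambda>x. f x + B *s x)) x
      = f (f (f x)) + (A + B - 1) *s f (f x) - (A + B - 1) *s f x - x"
    by (simp add: add scale vec_eq_iff algebra_simps AB')
  then show "((\<lambda>x. f x - x) \<circ> (\<lambda>x. f x + A *s x) \<circ> (\<lambda>x. f x + B *s x)) x = 0"
    by (simp only: cubic)
qed

lemma power_int_minus_2: "(Q::'k::field) powi (-2) = inverse Q ^ 2"
  by (simp add: power_int_minus power_inverse)

text \<open>Clearing the denominator leaves the nonzero polynomial \<open>1 + X^2\<close>. The two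
  eigenvalues of \<open>T\<close> are therefore distinct.\<close>

lemma q_plus_inverse_nonzero: "q + inverse q \<noteq> 0"
proof
  assume "q + inverse q = 0"
  then have "q * (q + inverse q) = 0" by (simp only: mult_zero_right)
  then have "q * q + 1 = 0" by (simp only: distrib_left right_inverse[OF q_nonzero])
  then have "Fract ([:1, 0, 1:] :: complex poly) 1 = Fract 0 1"
    by (simp add: q_def One_fract_def Zero_fract_def one_pCons)
  then show False by (simp add: eq_fract)
qed

lemma hecke_triple_T:
  "hecke_triple q (on_left T) (middle T)
    (id \<otimes>\<^sub>m T :: 'n::{finite, linorder} square2 \<Rightarrow> 'n square2)"
  unfolding T_eq_hecke by (rule hecke_triple_square[OF q_nonzero])

text \<open>Rebracketing carries the sums defining \<open>Psi\<close> and its inverse, term by term,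
  to the expansions of \<open>psi\<close> and \<open>psi_inv\<close>.\<close>

lemma Psi_tensor4_factors:
  "assoc (Psi1 x) = on_left T (assoc x)" "assoc (Psi2 x) = middle T (assoc x)"
  "assoc (Psi3 x) = (id \<otimes>\<^sub>m T) (assoc x)"
  by (simp_all only: Psi1_def Psi2_def Psi3_def assoc_on_left_on_left[OF linear_T]
      assoc_on_left_on_right assoc_on_right)

lemma Psi_eq_psi: "Psi = hecke_triple.psi q (on_left T) (middle T) (id \<otimes>\<^sub>m T)"
proof
  fix x :: "'a square2"
  interpret hecke_triple q "on_left T" "middle T" "id \<otimes>\<^sub>m T :: 'a square2 \<Rightarrow> _"
    by (rule hecke_triple_T)
  interpret assoc: Vector_Spaces.linear "(*s)" "(*s)" "assoc :: 'a tensor4 \<Rightarrow> _"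
    by (rule linear_assoc)
  show "Psi x = psi x"
    by (simp only: psi_expand Psi_def regroup_def Psi_tensor4_def comp_apply assoc.add assoc.scale
        Psi_tensor4_factors assoc_inverse h_def)
qed

lemma regroup_Psi_inv_eq_psi_inv:
  "regroup Psi_inv_tensor4 = hecke_triple.psi_inv q (on_left T) (middle T) (id \<otimes>\<^sub>m T)"
proof
  fix x :: "'a square2"
  interpret hecke_triple q "on_left T" "middle T" "id \<otimes>\<^sub>m T :: 'a square2 \<Rightarrow> _"
    by (rule hecke_triple_T)
  interpret assoc: Vector_Spaces.linear "(*s)" "(*s)" "assoc :: 'a tensor4 \<Rightarrow> _"
    by (rule linear_assoc)
  show "regroup Psi_inv_tensor4 x = psi_inv x"
    by (simp only: psi_inv_expand regroup_def Psi_inv_tensor4_def comp_apply assoc.add assoc.scale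
        Psi_tensor4_factors assoc_inverse h_def)
qed

theorem proposition1p10:
  assumes "CARD('n::{finite, linorder}) \<ge> 2"
  shows
    "(on_left (Psi :: 'n square2 \<Rightarrow> 'n square2) \<circ> on_right Psi \<circ> on_left Psi
        = on_right Psi \<circ> on_left Psi \<circ> on_right Psi)
     \<and> ((\<lambda>x :: 'n square2. Psi x - x) \<circ> (\<lambda>x. Psi x + q^2 *s x) \<circ> (\<lambda>x. Psi x + q powi (-2) *s x)
        = (\<lambda>x. 0))
     \<and> bij (Psi :: 'n square2 \<Rightarrow> 'n square2)
     \<and> inv (Psi :: 'n square2 \<Rightarrow> 'n square2) = regroup Psi_inv_tensor4
     \<and> vec.dim (range (\<lambda>x :: 'n square2. Psi x - x))
        = ext_square.dim (UNIV :: ('n \<times> 'n) ext_square set)"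
proof (intro conjI)
  interpret hecke_triple q "on_left T" "middle T" "id \<otimes>\<^sub>m T :: 'n square2 \<Rightarrow> _"
    by (rule hecke_triple_T)
  note Psi = Psi_eq_psi[where 'a = 'n]
  have inverse: "Psi \<circ> regroup Psi_inv_tensor4 = (id :: 'n square2 \<Rightarrow> 'n square2)"
    "regroup Psi_inv_tensor4 \<circ> Psi = (id :: 'n square2 \<Rightarrow> 'n square2)"
    unfolding Psi regroup_Psi_inv_eq_psi_inv
    by (simp_all only: fun_eq_iff comp_apply psi_inverses id_apply simp_thms)
  show "on_left (Psi :: 'n square2 \<Rightarrow> 'n square2) \<circ> on_right Psi \<circ> on_left Psi
      = on_right Psi \<circ> on_left Psi \<circ> on_right Psi"
    unfolding Psi T_eq_hecke by (rule psi_hecke_braid[OF q_nonzero])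
  show "(\<lambda>x :: 'n square2. Psi x - x) \<circ> (\<lambda>x. Psi x + q^2 *s x) \<circ> (\<lambda>x. Psi x + q powi (-2) *s x)
      = (\<lambda>x. 0)"
    unfolding power_int_minus_2
  proof (rule cubic_factors[OF linear_Psi])
    show "q^2 * inverse q^2 = 1"
      by (simp only: power_mult_distrib[symmetric] right_inverse[OF q_nonzero] power_one)
  qed (unfold Psi, rule psi_cubic)
  show "bij (Psi :: 'n square2 \<Rightarrow> 'n square2)"
    by (rule o_bij[OF inverse(2,1)])
  show "inv (Psi :: 'n square2 \<Rightarrow> 'n square2) = regroup Psi_inv_tensor4"
    by (rule inv_unique_comp[OF inverse])
  show "vec.dim (range (\<lambda>x :: 'n square2. Psi x - x))
      = ext_square.dim (UNIV :: ('n \<times> 'n) ext_square set)"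
    \<comment> \<open>Both dimensions \<open>d\<close> satisfy \<open>2 * d + N = N^2\<close> with
      \<open>N = CARD('n \<times> 'n)\<close>, so they agree.\<close>
    using dim_range_hecke_difference[OF q_nonzero q_plus_inverse_nonzero, where 'n = 'n]
      dim_ext_square[where 'a = "'n \<times> 'n"]
    unfolding Psi dim_range_psi_minus_id unfolding T_eq_hecke by linarith
qed

end
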